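(* Let $T_1,T_2,T_3$ be positive integers, and let $h_2$ and $h_3$ be as defined in the context. There exist three positive integers $p,q,r$ and a sequence $(a_j)_{j=0}^{pqr-q-r+1}$ of real numbers such that, for a suitable choice of the multiplicative constant in $h_3$, $$h_3(t)=\sum_{j=0}^{pqr-q-r+1}a_j\,h_2\bigl(t-j\gcd(T_1,T_2,T_3)\bigr).$$ Furthermore: (i) if $q=1$, then $(a_j)_{j=0}^{pqr-q-r+1}=(a_j)_{j=0}^{pr-r}$ is the beginning of the sequence $(1,0^{r-1})^{\infty}$; (ii) if $r=1$, then $(a_j)_{j=0}^{pqr-q-r+1}=(a_j)_{j=0}^{pq-q}$ is the beginning of the sequence $(1,0^{q-1})^{\infty}$; (iii) if $q\ge 2$ and $r\ge 2$, then the sequence $(a_j)_{j=0}^{pqr-q-r+1}$ is $qr$-periodic (i.e. it is an initial segment of a $qr$-periodic infinite sequence) and it is the beginning of the sequence $$\sum_{l=0}^{\infty}0^{lq}(1,-1,0^{r-2})^{\infty}=\sum_{l=0}^{\infty}0^{lr}(1,-1,0^{q-2})^{\infty}.$$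
   Context: For a positive real number $S$, $X_S$ denotes the vector space of locally square summable, $S$-periodic functions (complex-valued, on $\mathbb R$) with zero mean value over a period. The function $h_2$ (for the pair $T_1,T_2$) is $$h_2(t):=\sum_{j=0}^{\frac{T_2}{\gcd(T_1,T_2)}-1}h_1\bigl(t-j\gcd(T_1,T_2)\bigr),\qquad h_1:=\chi_{[0,T_1)},$$ which spans the orthogonal complement of $X_{T_1}+X_{T_2}$ in $L^2(0,T_{12})$, $T_{12}:=T_1+T_2-\gcd(T_1,T_2)$, and is zero outside $[0,T_{12})$. Put $$T:=T_1+T_2+T_3-\gcd(T_1,T_2)-\gcd(T_2,T_3)-\gcd(T_3,T_1)+\gcd(T_1,T_2,T_3).$$ It is known from earlier work that the orthogonal complement in $L^2(0,T)$ of (the restrictions to $(0,T)$ of the functions of) $X_{T_1}+X_{T_2}+X_{T_3}$ is one-dimensional and spanned by a real-valued function; $h_3$ denotes such a nonzero real-valued function, extended by $0$ outside $(0,T)$. It is determined up to a nonzero real multiplicative constant, and up to equality almost everywhere. Notation for sequences (indexed from $0$): $0^k$ denotes a block of $k$ consecutive zeros; $(w)^\infty$ denotes the infinite periodic repetition of the finite block $w$, e.g. $(1,-1,0^3)^\infty=1,-1,0,0,0,1,-1,0,0,0,\ldots$. $0^{k}(w)^\infty$ is the sequence $(w)^\infty$ preceded by $k$ zeros. The infinite sums of sequences are taken term by term (for each index only finitely many summands are nonzero). *)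

theory Defs
  imports "HOL-Analysis.Analysis"
begin

text \<open>Square integrable functions are represented by Lebesgue measurable functions
  (not by classes modulo null sets).\<close>

definition L2 :: "real set \<Rightarrow> (real \<Rightarrow> complex) set" where
  "L2 A = {f. set_borel_measurable lebesgue A f \<and>
              set_integrable lebesgue A (\<lambda>t. (cmod (f t))\<^sup>2)}"

definition X :: "real \<Rightarrow> (real \<Rightarrow> complex) set" where
  "X S = {f. (\<forall>a b. f \<in> L2 {a..b}) \<and>
             (\<forall>t. f (t + S) = f t) \<and>
             (LINT t:{0..S}|lebesgue. f t) = 0}"

definition orth_compl :: "real \<Rightarrow> (real \<Rightarrow> complex) set \<Rightarrow> (real \<Rightarrow> complex) set" where
  "orth_compl T V = {f \<in> L2 {0<..<T}.
     \<forall>u\<in>V. (LINT t:{0<..<T}|lebesgue. u t * cnj (f t)) = 0}"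

definition X_sum3 :: "real \<Rightarrow> real \<Rightarrow> real \<Rightarrow> (real \<Rightarrow> complex) set" where
  "X_sum3 S1 S2 S3 = {\<lambda>t. u t + v t + w t | u v w. u \<in> X S1 \<and> v \<in> X S2 \<and> w \<in> X S3}"

definition h1 :: "nat \<Rightarrow> real \<Rightarrow> real" where
  "h1 T1 = indicator {0..<real T1}"

definition h2 :: "nat \<Rightarrow> nat \<Rightarrow> real \<Rightarrow> real" where
  "h2 T1 T2 t = (\<Sum>j<T2 div gcd T1 T2. h1 T1 (t - real j * real (gcd T1 T2)))"

definition gcd3 :: "nat \<Rightarrow> nat \<Rightarrow> nat \<Rightarrow> nat" where
  "gcd3 T1 T2 T3 = gcd T1 (gcd T2 T3)"

definition T123 :: "nat \<Rightarrow> nat \<Rightarrow> nat \<Rightarrow> real" where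
  "T123 T1 T2 T3 = real T1 + real T2 + real T3
     - real (gcd T1 T2) - real (gcd T2 T3) - real (gcd T3 T1) + real (gcd3 T1 T2 T3)"

text \<open>A valid choice of \<open>h\<^sub>3\<close>.  The orthogonal complement is known to be one-dimensional, so a
  nonzero real-valued element of it is the same thing as a real-valued function spanning it;
  one-dimensionality itself is not built into the definition.\<close>

definition is_h3 :: "nat \<Rightarrow> nat \<Rightarrow> nat \<Rightarrow> (real \<Rightarrow> real) \<Rightarrow> bool" where
  "is_h3 T1 T2 T3 h \<longleftrightarrow>
     (\<lambda>t. complex_of_real (h t)) \<in>
        orth_compl (T123 T1 T2 T3) (X_sum3 (real T1) (real T2) (real T3)) \<and>
     \<not> (AE t in lebesgue. h t = 0) \<and>
     (\<forall>t. t \<notin> {0<..<T123 T1 T2 T3} \<longrightarrow> h t = 0)"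

text \<open>The index \<open>pqr - q - r + 1\<close>, written so that subtraction on \<^typ>\<open>nat\<close> does not truncate:
  \<open>q + r \<le> qr + 1 \<le> pqr + 1\<close> for positive \<open>p, q, r\<close>.\<close>

definition last_index :: "nat \<Rightarrow> nat \<Rightarrow> nat \<Rightarrow> nat" where
  "last_index p q r = p * q * r + 1 - q - r"

text \<open>\<open>rep w\<close> is the sequence \<open>(w)\<^sup>\<infinity>\<close>, and \<open>zeros_before k s\<close> is \<open>0\<^sup>k s\<close>.\<close>

definition rep :: "real list \<Rightarrow> nat \<Rightarrow> real" where
  "rep w n = w ! (n mod length w)"

definition zeros_before :: "nat \<Rightarrow> (nat \<Rightarrow> real) \<Rightarrow> nat \<Rightarrow> real" where
  "zeros_before k s n = (if n < k then 0 else s (n - k))"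

text \<open>The sequence \<open>\<Sum>\<^sub>l 0\<^sup>l\<^sup>m (1, -1, 0\<^sup>k\<^sup>-\<^sup>2)\<^sup>\<infinity>\<close>, summed term by term; for \<open>m \<ge> 1\<close> only
  the summands with \<open>l m \<le> n\<close> can be nonzero at index \<open>n\<close>.\<close>

definition shifted_sum :: "nat \<Rightarrow> nat \<Rightarrow> nat \<Rightarrow> real" where
  "shifted_sum m k n = (\<Sum>l. zeros_before (l * m) (rep ([1, -1] @ replicate (k - 2) 0)) n)"

end

theory Submission
  imports Defs "HOL-Computational_Algebra.Polynomial_FPS"
    "HOL-Computational_Algebra.Polynomial_Factorial" "HOL-Computational_Algebra.Field_as_Ring"
begin

text \<open>
  Put \<open>d = gcd(T\<^sub>1,T\<^sub>2,T\<^sub>3)\<close> and \<open>T\<^sub>i = d A\<^sub>i\<close>.  Orthogonality of \<open>h\<close> to \<open>X S\<close> means that the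
  periodization \<open>\<Sum>\<^sub>k h(t + kS)\<close> is almost everywhere constant.  On a fiber \<open>s + d\<nat>\<close> the values of
  \<open>h\<^sub>3\<close> are thus the coefficients of a polynomial \<open>H\<^sub>s\<close> of degree below \<open>N = T/d\<close> that vanishes at all
  nontrivial \<open>A\<^sub>i\<close>-th roots of unity, and \<open>H\<^sub>s(1)\<close> does not depend on \<open>s\<close>.  By inclusion-exclusion
  there are \<open>N - 1\<close> such roots, so \<open>H\<^sub>s\<close> is determined up to a factor that is the same for all \<open>s\<close>.
  With \<open>q = gcd(A\<^sub>1,A\<^sub>3)\<close>, \<open>r = gcd(A\<^sub>2,A\<^sub>3)\<close> and \<open>A\<^sub>3 = pqr\<close>, a polynomial with these roots is the
  product of the one belonging to \<open>h\<^sub>2\<close> and \<open>(1 - x)(1 - x\<^sup>p\<^sup>q\<^sup>r) / ((1 - x\<^sup>q)(1 - x\<^sup>r))\<close>, and the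
  coefficients of the latter are the \<open>a\<^sub>j\<close>.
\<close>

subsection \<open>Geometric polynomials\<close>

text \<open>For \<open>m > 0\<close> this is \<open>(x^(m n) - 1) / (x^m - 1)\<close>, written as a
  sum so that no division is involved.\<close>

definition geo_poly :: "nat \<Rightarrow> nat \<Rightarrow> 'a::comm_ring_1 poly" where
  "geo_poly m n = (\<Sum>j<n. monom 1 (m * j))"

lemma poly_geo_poly: "poly (geo_poly m n) z = (\<Sum>j<n. z ^ (m * j))"
  by (simp add: geo_poly_def poly_sum poly_monom)

lemma poly_geo_poly_1 [simp]: "poly (geo_poly m n) 1 = of_nat n"
  by (simp add: poly_geo_poly)

lemma coeff_geo_poly_one: "coeff (geo_poly 1 n) k = (if k < n then 1 else 0)"
  by (simp add: geo_poly_def coeff_sum)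

lemma geo_poly_telescope: "(monom 1 m - 1) * geo_poly m n = (monom 1 (m * n) - 1 :: 'a::comm_ring_1 poly)"
proof -
  have *: "monom (1::'a) (m * j) = monom 1 m ^ j" for j
    by (simp add: monom_power)
  show ?thesis
    unfolding geo_poly_def * power_diff_1_eq ..
qed

lemma monom_minus_one_nonzero: "m > 0 \<Longrightarrow> (monom 1 m - 1 :: 'a::comm_ring_1 poly) \<noteq> 0"
  by (metis degree_1 degree_monom_eq eq_iff_diff_eq_0 less_irrefl zero_neq_one)

text \<open>After multiplication by the nonzero factor \<open>x^m - 1\<close>, both sides telescope
  to \<open>x^(m a b) - 1\<close>.\<close>

lemma geo_poly_mult:
  assumes "m > 0"
  shows "geo_poly m (a * b) = geo_poly m a * (geo_poly (m * a) b :: 'a::idom poly)"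
proof (cases "a = 0")
  case False
  have "(monom 1 m - 1) * (geo_poly m a * geo_poly (m * a) b) = (monom 1 m - 1) * (geo_poly m (a * b) :: 'a poly)"
    by (simp add: geo_poly_telescope mult.assoc [symmetric])
  with monom_minus_one_nonzero [OF assms] show ?thesis
    by (metis mult_left_cancel)
qed (simp add: geo_poly_def)

lemma geo_poly_nonzero: "n > 0 \<Longrightarrow> geo_poly m n \<noteq> (0 :: 'a::{comm_ring_1,ring_char_0} poly)"
  by (metis of_nat_0_eq_iff poly_0 poly_geo_poly_1 less_irrefl)

lemma degree_geo_poly:
  assumes "m > 0" "n > 0"
  shows "degree (geo_poly m n :: 'a::{idom,ring_char_0} poly) = m * (n - 1)"
proof -
  have deg: "degree (monom 1 k - 1 :: 'a poly) = k" if "k > 0" for k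
    using degree_add_eq_left [of "-1" "monom (1::'a) k"] that by (simp add: degree_monom_eq)
  have "degree ((monom 1 m - 1) * geo_poly m n :: 'a poly) = m + degree (geo_poly m n :: 'a poly)"
    using assms monom_minus_one_nonzero [OF assms(1), where 'a='a]
    by (simp add: degree_mult_eq geo_poly_nonzero deg)
  moreover have "degree ((monom 1 m - 1) * geo_poly m n :: 'a poly) = m * n"
    using assms by (simp add: geo_poly_telescope deg)
  ultimately show ?thesis
    by (simp add: diff_mult_distrib2)
qed

text \<open>A Bezout relation \<open>m x = n y + 1\<close> lifts to polynomials:
  \<open>geo_poly 1 (m * x)\<close> minus \<open>monom 1 1 * geo_poly 1 (n * y)\<close> is 1, and
  the two terms are multiples of \<open>geo_poly 1 m\<close> and
  \<open>geo_poly 1 n\<close>.\<close>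

lemma coprime_geo_poly:
  assumes "coprime q r" "q > 0" "r > 0"
  shows "coprime (geo_poly 1 q) (geo_poly 1 r :: 'a::field_gcd poly)"
proof -
  have dvd: "geo_poly 1 m dvd (geo_poly 1 (m * x) :: 'a poly)" for m x
    by (simp add: geo_poly_mult)
  have *: "coprime (geo_poly 1 m) (geo_poly 1 n :: 'a poly)" if "m * x = n * y + 1" for m n x y
  proof (rule coprimeI)
    fix c :: "'a poly"
    assume c: "c dvd geo_poly 1 m" "c dvd geo_poly 1 n"
    have "geo_poly 1 (m * x) - monom 1 1 * geo_poly 1 (n * y) = (1 :: 'a poly)"
      unfolding that by (rule poly_eqI) (auto simp: coeff_geo_poly_one [simplified] coeff_monom_mult)
    moreover have "c dvd geo_poly 1 (m * x) - monom 1 1 * geo_poly 1 (n * y)"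
      using c dvd by (meson dvd_diff dvd_mult dvd_trans)
    ultimately show "c dvd 1" by simp
  qed
  obtain x y where "q * x = r * y + gcd q r"
    using bezout_nat [of q r] assms by auto
  with assms * show ?thesis by simp
qed

text \<open>Each factor divides by \<open>geo_poly_mult\<close>, and coprimality makes their product
  divide. The coefficients of \<open>P\<close> will be the numbers \<open>a_j\<close>.\<close>

lemma geo_poly_quotient_exists:
  assumes "coprime q r" "q > 0" "r > 0"
  obtains P :: "'a::field_gcd poly" where "geo_poly 1 (p * q * r) = P * geo_poly 1 q * geo_poly 1 r"
proof -
  have "geo_poly 1 q dvd (geo_poly 1 (p * q * r) :: 'a poly)" 
    by (metis dvd_triv_left geo_poly_mult mult.assoc mult.commute zero_less_one)
  moreover have "geo_poly 1 r dvd (geo_poly 1 (p * q * r) :: 'a poly)"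
    by (metis dvd_triv_left geo_poly_mult mult.commute zero_less_one)
  ultimately have "geo_poly 1 q * geo_poly 1 r dvd (geo_poly 1 (p * q * r) :: 'a poly)"
    using coprime_geo_poly [OF assms] by (rule divides_mult)
  then show ?thesis
    by (metis that dvd_def mult.assoc mult.commute)
qed

lemma degree_geo_poly_quotient:
  fixes P :: "'a::{idom,ring_char_0} poly"
  assumes "geo_poly 1 (p * q * r) = P * geo_poly 1 q * geo_poly 1 r" "p > 0" "q > 0" "r > 0"
  shows "degree P = last_index p q r"
proof -
  have "p * q * r > 0" using assms by simp
  then have "P \<noteq> 0"
    using assms(1) geo_poly_nonzero[of "p * q * r" 1] by auto
  then have "degree (geo_poly 1 (p * q * r) :: 'a poly) = degree P + (q - 1) + (r - 1)"
    unfolding assms(1) using assms by (simp add: degree_mult_eq geo_poly_nonzero degree_geo_poly)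
  then show ?thesis
    using assms(2-4) \<open>p * q * r > 0\<close> by (simp add: degree_geo_poly last_index_def)
qed

subsection \<open>The quotient as a power series\<close>

lemma fps_of_geo_poly: "(1 - fps_X ^ m) * fps_of_poly (geo_poly m n) = (1 - fps_X ^ (m * n) :: 'a::comm_ring_1 fps)"
proof -
  have "fps_of_poly ((monom 1 m - 1) * geo_poly m n) = (fps_X ^ (m * n) - 1 :: 'a fps)"
    unfolding geo_poly_telescope by (simp add: fps_of_poly_diff fps_of_poly_monom)
  then have "(fps_X ^ m - 1) * fps_of_poly (geo_poly m n) = (fps_X ^ (m * n) - 1 :: 'a fps)"
    by (simp add: fps_of_poly_diff fps_of_poly_monom fps_of_poly_mult)
  then show ?thesis by (simp add: algebra_simps)
qed

lemma one_minus_X_power_nonzero: "m > 0 \<Longrightarrow> (1 - fps_X ^ m :: 'a::idom fps) \<noteq> 0"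
  by (metis eq_iff_diff_eq_0 fps_X_power_nth fps_one_nth less_irrefl zero_neq_one)

text \<open>Each \<open>geo_poly 1 n\<close> becomes \<open>1 - x^n\<close> when multiplied by
  \<open>1 - x\<close>; the rest is cancellation. \<open>F\<close> is kept abstract, so that every
  explicit sequence of the theorem can be tested against the same equation.\<close>

lemma geo_poly_quotient_fps:
  fixes P :: "'a::idom poly"
  assumes P: "geo_poly 1 (p * q * r) = P * geo_poly 1 q * geo_poly 1 r"
    and F: "F * (1 - fps_X ^ q) * (1 - fps_X ^ r) = 1 - fps_X" and "q > 0" "r > 0"
  shows "fps_of_poly P = F * (1 - fps_X ^ (p * q * r))"
proof -
  let ?x = "1 - fps_X :: 'a fps" and ?q = "1 - fps_X ^ q :: 'a fps" and ?r = "1 - fps_X ^ r :: 'a fps"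
  have g: "?x * fps_of_poly (geo_poly 1 n) = 1 - fps_X ^ n" for n
    using fps_of_geo_poly [of 1 n] by simp
  have "?x * fps_of_poly P * ?q * ?r = ?x * fps_of_poly P * (?x * fps_of_poly (geo_poly 1 q)) * (?x * fps_of_poly (geo_poly 1 r))"
    by (simp only: g)
  also have "\<dots> = ?x * ?x * (?x * fps_of_poly (geo_poly 1 (p * q * r)))"
    by (simp only: P fps_of_poly_mult) (simp only: ac_simps)
  also have "\<dots> = ?x * ?x * (1 - fps_X ^ (p * q * r))"
    by (simp only: g)
  also have "\<dots> = ?x * (F * (1 - fps_X ^ (p * q * r))) * ?q * ?r"
    unfolding F [symmetric] by (simp only: ac_simps)
  finally have "?x * fps_of_poly P = ?x * (F * (1 - fps_X ^ (p * q * r)))"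
    by (metis mult_right_cancel one_minus_X_power_nonzero \<open>q > 0\<close> \<open>r > 0\<close>)
  then show ?thesis
    by (metis mult_left_cancel one_minus_X_power_nonzero power_one_right zero_less_one)
qed

text \<open>\<open>F\<close> is \<open>(1 - x) / ((1 - x\<^sup>q)(1 - x\<^sup>r))\<close>; the remaining factor \<open>1 - x\<^sup>p\<^sup>q\<^sup>r\<close> of the quotient only affects
  indices beyond its degree.\<close>

lemma coeff_geo_poly_quotient:
  fixes P :: "'a::{idom,ring_char_0} poly"
  assumes P: "geo_poly 1 (p * q * r) = P * geo_poly 1 q * geo_poly 1 r"
    and F: "F * (1 - fps_X ^ q) * (1 - fps_X ^ r) = 1 - fps_X" and "p > 0" "q > 0" "r > 0"
    and j: "j \<le> last_index p q r"
  shows "coeff P j = fps_nth F j"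
proof -
  have "p * q * r > 0" using assms by simp
  then have "j < p * q * r" 
    using j \<open>q > 0\<close> \<open>r > 0\<close> unfolding last_index_def by linarith
  moreover have "coeff P j = fps_nth (F - F * fps_X ^ (p * q * r)) j"
    using arg_cong [OF geo_poly_quotient_fps [OF P F \<open>q > 0\<close> \<open>r > 0\<close>], of "\<lambda>f. fps_nth f j"]
    by (simp add: algebra_simps)
  ultimately show ?thesis
    by (simp add: fps_X_power_mult_right_nth)
qed

text \<open>The quotient for \<open>p = 1\<close> shows that \<open>F (1 - x^(q r))\<close> is a
  polynomial of degree below \<open>q r\<close>, so its coefficients from index \<open>q r\<close>
  on vanish.\<close>

lemma fps_periodic:
  fixes F :: "real fps"
  assumes F: "F * (1 - fps_X ^ q) * (1 - fps_X ^ r) = 1 - fps_X"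
    and "coprime q r" "q \<ge> 2" "r > 0"
  shows "fps_nth F (j + q * r) = fps_nth F j"
proof -
  have "q > 0" using \<open>q \<ge> 2\<close> by simp
  obtain P :: "real poly" where P: "geo_poly 1 (1 * q * r) = P * geo_poly 1 q * geo_poly 1 r"
    by (rule geo_poly_quotient_exists [OF \<open>coprime q r\<close> \<open>q > 0\<close> \<open>r > 0\<close>])
  have "q * r > 0"
    using \<open>q > 0\<close> \<open>r > 0\<close> by simp
  moreover have "degree P = q * r + 1 - q - r"
    using degree_geo_poly_quotient [OF P] \<open>q > 0\<close> \<open>r > 0\<close> by (simp add: last_index_def)
  ultimately have "degree P < q * r"
    using \<open>q \<ge> 2\<close> \<open>r > 0\<close> by linarith
  then have "fps_nth (F - F * fps_X ^ (q * r)) (j + q * r) = 0"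
    using arg_cong [OF geo_poly_quotient_fps [OF P F \<open>q > 0\<close> \<open>r > 0\<close>], of "\<lambda>f. fps_nth f (j + q * r)"]
    by (simp add: algebra_simps coeff_eq_0)
  then show ?thesis
    by (simp add: fps_X_power_mult_right_nth)
qed

text \<open>Multiplication by \<open>1 - x^k\<close> subtracts the sequence delayed by one period,
  so only the first block survives.\<close>

lemma rep_fps:
  assumes "k > 0" "length w = k"
  shows "Abs_fps (rep w) * (1 - fps_X ^ k) = fps_of_poly (Poly w)"
proof (rule fps_ext)
  fix n
  show "fps_nth (Abs_fps (rep w) * (1 - fps_X ^ k)) n = fps_nth (fps_of_poly (Poly w)) n"
  proof (cases "n < k")
    case True
    then show ?thesis using assms
      by (simp add: right_diff_distrib fps_X_power_mult_right_nth rep_def coeff_Poly_eq nth_default_def)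
  next
    case False
    then have "n mod k = (n - k) mod k" by (simp add: le_mod_geq)
    with False show ?thesis using assms
      by (simp add: right_diff_distrib fps_X_power_mult_right_nth rep_def coeff_Poly_eq nth_default_def)
  qed
qed

lemma fps_rep_one:
  assumes "k > 0"
  shows "Abs_fps (rep (1 # replicate (k - 1) 0)) * (1 - fps_X ^ k) = 1"
proof -
  have "Poly (1 # replicate (k - 1) 0) = (1 :: real poly)"
    by (rule poly_eqI) (simp add: coeff_Poly_eq nth_default_def nth_Cons' coeff_pCons split: nat.splits)
  with rep_fps [of k "1 # replicate (k - 1) 0"] assms show ?thesis by simp
qed

lemma fps_rep_one_minus:
  assumes "k \<ge> 2"
  shows "Abs_fps (rep ([1, -1] @ replicate (k - 2) 0)) * (1 - fps_X ^ k) = 1 - fps_X"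
proof -
  have "Poly ([1, -1] @ replicate (k - 2) 0) = (1 - [:0, 1:] :: real poly)"
    by (rule poly_eqI) (auto simp: coeff_Poly_eq nth_default_def nth_Cons' coeff_pCons coeff_1 split: nat.splits)
  with rep_fps [of k "[1, -1] @ replicate (k - 2) 0"] assms show ?thesis
    by (simp add: fps_of_poly_diff fps_of_poly_fps_X)
qed

lemma shifted_sum_rec:
  assumes "m > 0"
  shows "shifted_sum m k n = rep ([1, -1] @ replicate (k - 2) 0) n
    + (if n < m then 0 else shifted_sum m k (n - m))"
proof -
  let ?z = "\<lambda>n l. zeros_before (l * m) (rep ([1, -1] @ replicate (k - 2) 0)) n"
  \<comment> \<open>As \<open>m > 0\<close>, a summand with \<open>l > n\<close> begins with more
    than \<open>n\<close> zeros and contributes nothing at index \<open>n\<close>.\<close>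
  have fin: "summable (?z n)" for n
    by (rule summable_finite [of "{..n}"])
      (use assms in \<open>auto simp: zeros_before_def not_le intro: less_le_trans\<close>)
  have "shifted_sum m k n = ?z n 0 + (\<Sum>l. ?z n (Suc l))"
    unfolding shifted_sum_def using suminf_split_head [OF fin, of n] by simp
  also have "(\<Sum>l. ?z n (Suc l)) = (if n < m then 0 else shifted_sum m k (n - m))"
  proof (cases "n < m")
    case False
    then have "?z n (Suc l) = ?z (n - m) l" for l
      by (auto simp: zeros_before_def)
    with False show ?thesis by (simp add: shifted_sum_def)
  qed (simp add: zeros_before_def)
  finally show ?thesis by (simp add: zeros_before_def)
qed

text \<open>By \<open>shifted_sum_rec\<close> the factor \<open>1 - x^m\<close> leaves only the
  summand \<open>l = 0\<close>, which \<open>1 - x^k\<close> reduces to \<open>1 - x\<close>. The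
  equation is symmetric in \<open>m\<close> and \<open>k\<close>; this is why the two sums in case
  (iii) coincide.\<close>

lemma fps_shifted_sum:
  assumes "m > 0" "k \<ge> 2"
  shows "Abs_fps (shifted_sum m k) * (1 - fps_X ^ m) * (1 - fps_X ^ k) = 1 - fps_X"
proof -
  have "Abs_fps (shifted_sum m k) * (1 - fps_X ^ m) = Abs_fps (rep ([1, -1] @ replicate (k - 2) 0))"
    by (rule fps_ext, subst right_diff_distrib)
      (use shifted_sum_rec [OF \<open>m > 0\<close>, of k] in \<open>simp add: fps_X_power_mult_right_nth\<close>)
  then show ?thesis by (simp only: fps_rep_one_minus [OF \<open>k \<ge> 2\<close>])
qed

subsection \<open>Polynomials vanishing on roots of unity\<close>

text \<open>Inclusion-exclusion: the \<open>m\<close>-th and the \<open>n\<close>-th roots of unity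
  have exactly the \<open>gcd m n\<close>-th ones in common. The summand 1 counts the triple
  intersection, which contains only the root 1.\<close>

lemma card_roots_of_unity_union:
  assumes "a > 0" "b > 0" "c > 0" "gcd a (gcd b c) = 1"
  shows "finite {z::complex. z ^ a = 1 \<or> z ^ b = 1 \<or> z ^ c = 1}"
    and "card {z::complex. z ^ a = 1 \<or> z ^ b = 1 \<or> z ^ c = 1} = a + b + c + 1 - gcd a b - gcd b c - gcd c a"
proof -
  define U where "U n = {z::complex. z ^ n = 1}" for n :: nat
  have fin: "finite (U n)" and card: "card (U n) = n" if "n > 0" for n
    using that card_roots_unity_eq [of n] by (auto simp: U_def finite_roots_unity)
  have int: "U m \<inter> U n = U (gcd m n)" if mn: "m > 0" for m n
  proof -
    obtain x y where "m * x = n * y + gcd m n"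
      using bezout_nat [of m n] mn by auto
    then have "z ^ gcd m n = 1" if "z ^ m = 1" "z ^ n = 1" for z :: complex
      using that by (metis mult_1 power_add power_mult power_one)
    moreover have "z ^ m = 1" "z ^ n = 1" if "z ^ gcd m n = 1" for z :: complex
      using that by (metis dvd_mult_div_cancel gcd_dvd1 gcd_dvd2 power_mult power_one)+
    ultimately show ?thesis by (auto simp: U_def)
  qed
  have eq: "{z::complex. z ^ a = 1 \<or> z ^ b = 1 \<or> z ^ c = 1} = (U a \<union> U b) \<union> U c"
    by (auto simp: U_def)
  have "(U a \<union> U b) \<inter> U c = U (gcd a c) \<union> U (gcd b c)"
    using assms by (simp add: Int_Un_distrib2 int)
  moreover have "gcd (gcd a c) (gcd b c) = 1"
    using assms(4) by (metis gcd.assoc gcd.commute gcd.left_idem)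
  ultimately have "card ((U a \<union> U b) \<inter> U c) + 1 = gcd a c + gcd b c"
    using card_Un_Int [of "U (gcd a c)" "U (gcd b c)"] assms by (simp add: fin card int)
  moreover have "card (U a \<union> U b) + gcd a b = a + b"
    using card_Un_Int [of "U a" "U b"] assms by (simp add: fin card int)
  moreover have "card (U a \<union> U b \<union> U c) + card ((U a \<union> U b) \<inter> U c) = card (U a \<union> U b) + c"
    using card_Un_Int [of "U a \<union> U b" "U c"] assms by (simp add: fin card del: Un_iff)
  ultimately show "card {z::complex. z ^ a = 1 \<or> z ^ b = 1 \<or> z ^ c = 1} = a + b + c + 1 - gcd a b - gcd b c - gcd c a"
    unfolding eq by (simp add: gcd.commute [of c a])
  show "finite {z::complex. z ^ a = 1 \<or> z ^ b = 1 \<or> z ^ c = 1}"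
    unfolding eq using assms by (simp add: fin)
qed

lemma sum_residue_classes:
  fixes g :: "nat \<Rightarrow> 'a::comm_monoid_add"
  shows "sum g {..<A * N} = (\<Sum>j<A. \<Sum>k<N. g (j + A * k))"
proof -
  have "sum g {..<A * N} = (\<Sum>k<N. \<Sum>i=k * A..<k * A + A. g i)"
    by (simp add: sum.nat_group mult.commute)
  also have "\<dots> = (\<Sum>k<N. \<Sum>j<A. g (j + A * k))"
  proof (rule sum.cong [OF refl])
    fix k
    show "(\<Sum>i=k * A..<k * A + A. g i) = (\<Sum>j<A. g (j + A * k))"
      using sum.shift_bounds_nat_ivl [of g 0 "k * A" A]
      by (simp add: ac_simps lessThan_atLeast0)
  qed
  finally show ?thesis
    by (simp only: sum.swap [of _ "{..<N}"])
qed

section \<open>Real polynomials evaluated at complex roots of unity\<close>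

abbreviation complex_poly :: "real poly \<Rightarrow> complex poly" where
  "complex_poly \<equiv> map_poly complex_of_real"

lemma complex_poly_mult: "complex_poly (p * q) = complex_poly p * complex_poly q"
  by (rule poly_eqI) (simp add: coeff_map_poly coeff_mult)

lemma complex_poly_diff: "complex_poly (p - q) = complex_poly p - complex_poly q"
  by (rule poly_eqI) (simp add: coeff_map_poly)

lemma complex_poly_smult: "complex_poly (smult c p) = smult (of_real c) (complex_poly p)"
  by (rule poly_eqI) (simp add: coeff_map_poly)

lemma complex_poly_sum: "complex_poly (sum f A) = (\<Sum>x\<in>A. complex_poly (f x))"
  by (rule poly_eqI) (simp add: coeff_map_poly coeff_sum)

lemma complex_poly_geo_poly: "complex_poly (geo_poly m n) = geo_poly m n"
  by (simp add: geo_poly_def complex_poly_sum map_poly_monom)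

lemma degree_complex_poly: "degree (complex_poly p) = degree p"
  by (simp add: degree_map_poly)

lemma poly_geo_poly_telescope: "(z ^ m - 1) * poly (geo_poly m n) z = z ^ (m * n) - (1 :: 'a::comm_ring_1)"
  using arg_cong [OF geo_poly_telescope [of m n, where 'a='a], of "\<lambda>p. poly p z"]
  by (simp add: poly_monom)

lemma poly_geo_poly_root_of_unity:
  fixes z :: "'a::idom"
  shows "z ^ n = 1 \<Longrightarrow> z \<noteq> 1 \<Longrightarrow> poly (geo_poly 1 n) z = 0"
  using poly_geo_poly_telescope [of z 1 n] by simp

lemma real_poly_eq_0_if_vanishing_on_roots_of_unity:
  assumes "a > 0" "b > 0" "c > 0" "gcd a (gcd b c) = 1"
    and deg: "degree E < a + b + c + 1 - gcd a b - gcd b c - gcd c a"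
    and "\<And>z. z ^ a = 1 \<or> z ^ b = 1 \<or> z ^ c = 1 \<Longrightarrow> poly (complex_poly E) z = 0"
  shows "E = 0"
proof (rule ccontr)
  assume "E \<noteq> 0"
  then have nz: "complex_poly E \<noteq> 0"
    by (simp add: map_poly_eq_0_iff)
  have "card {z::complex. z ^ a = 1 \<or> z ^ b = 1 \<or> z ^ c = 1} \<le> card {z. poly (complex_poly E) z = 0}"
    using assms(6) by (intro card_mono poly_roots_finite nz) auto
  also have "\<dots> \<le> degree E"
    using card_poly_roots_bound [OF nz] by (simp add: degree_complex_poly)
  finally show False
    using deg card_roots_of_unity_union(2) [OF assms(1-4)] by simp
qed

section \<open>Three jointly coprime periods and the polynomial of a fiber\<close>

locale three_periods =
  fixes a b c :: nat
  assumes pos: "a > 0" "b > 0" "c > 0" and gcd_one: "gcd a (gcd b c) = 1"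
begin

definition N where "N = a + b + c + 1 - gcd a b - gcd b c - gcd c a"
definition q where "q = gcd a c"
definition r where "r = gcd b c"
definition p where "p = c div (q * r)"

lemma q_pos: "q > 0" and r_pos: "r > 0"
  using pos by (auto simp: q_def r_def)

lemma coprime_q_r: "coprime q r"
  using gcd_one unfolding q_def r_def coprime_iff_gcd_eq_1
  by (metis gcd.assoc gcd.commute gcd.left_idem)

lemma c_eq: "p * q * r = c"
proof -
  have "q * r dvd c"
    using coprime_q_r by (intro divides_mult) (simp_all add: q_def r_def)
  then show ?thesis by (simp add: p_def mult.assoc)
qed

lemma p_pos: "p > 0"
  using c_eq pos by (metis gr0I mult_zero_left less_irrefl)

text \<open>The values of \<open>h2\<close> on the grid of mesh \<open>d\<close>: the first factor
  encodes \<open>h1\<close>, the second the translates that are summed.\<close>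

definition h2_poly :: "real poly" where
  "h2_poly = geo_poly 1 a * geo_poly (gcd a b) (b div gcd a b)"

text \<open>With \<open>g = gcd a b\<close>, both forms equal \<open>geo_poly 1 g\<close> times
  \<open>geo_poly g (a div g)\<close> times \<open>geo_poly g (b div g)\<close>. The new form
  exhibits the \<open>b\<close>-th roots of unity as zeros.\<close>

lemma h2_poly_commute: "h2_poly = geo_poly 1 b * geo_poly (gcd a b) (a div gcd a b)"
proof -
  have "geo_poly 1 x = geo_poly 1 (gcd a b) * (geo_poly (gcd a b) (x div gcd a b) :: real poly)" if "gcd a b dvd x" for x
    using geo_poly_mult [of 1 "gcd a b" "x div gcd a b"] that by simp
  from this [of a] this [of b] show ?thesis
    by (simp add: h2_poly_def mult_ac)
qed

context
  fixes P :: "real poly"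
  assumes P: "geo_poly 1 (p * q * r) = P * geo_poly 1 q * geo_poly 1 r"
begin

text \<open>The two forms of \<open>h2_poly\<close> settle the \<open>a\<close>-th and
  \<open>b\<close>-th roots. Any other \<open>c\<close>-th root is a zero of \<open>P\<close>: it is
  a zero of \<open>geo_poly 1 c\<close>, but not of the factors for \<open>q\<close> and
  \<open>r\<close>, since \<open>q\<close> divides \<open>a\<close> and \<open>r\<close> divides
  \<open>b\<close>.\<close>

lemma quotient_h2_poly_root: 
  assumes "z ^ a = 1 \<or> z ^ b = 1 \<or> z ^ c = 1" "z \<noteq> 1"
  shows "poly (complex_poly (P * h2_poly)) z = 0"
proof -
  consider "z ^ a = 1" | "z ^ b = 1" | "z ^ c = 1" "z ^ a \<noteq> 1" "z ^ b \<noteq> 1"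
    using assms(1) by blast
  then show ?thesis
  proof cases
    case 1
    then show ?thesis using \<open>z \<noteq> 1\<close>
      by (simp add: h2_poly_def complex_poly_mult complex_poly_geo_poly poly_geo_poly_root_of_unity [simplified])
  next
    case 2
    then show ?thesis using \<open>z \<noteq> 1\<close>
      by (simp add: h2_poly_commute complex_poly_mult complex_poly_geo_poly poly_geo_poly_root_of_unity [simplified])
  next
    case 3
    have "z ^ q \<noteq> 1" "z ^ r \<noteq> 1"
      using 3(2,3) unfolding q_def r_def
      by (metis dvd_mult_div_cancel gcd_dvd1 power_mult power_one)+
    then have "poly (geo_poly 1 q) z \<noteq> 0" "poly (geo_poly 1 r) z \<noteq> 0"
      using poly_geo_poly_telescope [of z 1 q] poly_geo_poly_telescope [of z 1 r] by auto
    moreover have "poly (complex_poly P) z * poly (geo_poly 1 q) z * poly (geo_poly 1 r) z = 0"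
      using arg_cong [OF P, of "\<lambda>p. poly (complex_poly p) z"] 3(1) \<open>z \<noteq> 1\<close>
      by (simp add: complex_poly_mult complex_poly_geo_poly c_eq poly_geo_poly_root_of_unity [simplified])
    ultimately show ?thesis
      by (simp add: complex_poly_mult)
  qed
qed

lemma poly_one_nonzero: "poly (P * h2_poly) 1 \<noteq> 0"
proof -
  have "poly P 1 * real q * real r = real c"
    using arg_cong [OF P, of "\<lambda>p. poly p 1"] by (simp add: c_eq)
  then have "poly P 1 \<noteq> 0" using pos by auto
  moreover have "b div gcd a b > 0" using pos by (simp add: div_greater_zero_iff dvd_imp_le)
  ultimately show ?thesis using pos by (simp add: h2_poly_def)
qed

lemma degree_less: "degree (P * h2_poly) < N"
proof -
  let ?g = "gcd a b"
  have b: "b div ?g > 0" using pos by (simp add: div_greater_zero_iff dvd_imp_le)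
  have "degree (P * h2_poly) \<le> degree P + degree h2_poly"
    by (rule degree_mult_le)
  also have "\<dots> \<le> degree P + ((a - 1) + ?g * (b div ?g - 1))"
    unfolding h2_poly_def using degree_mult_le [of "geo_poly 1 a :: real poly" "geo_poly ?g (b div ?g)"] pos b
    by (simp add: degree_geo_poly)
  also have "?g * (b div ?g - 1) = b - ?g"
    by (simp add: diff_mult_distrib2)
  also have "degree P = c + 1 - q - r"
    using degree_geo_poly_quotient [OF P p_pos q_pos r_pos] by (simp add: last_index_def c_eq)
  finally have *: "degree (P * h2_poly) \<le> (c + 1 - q - r) + (a - 1 + (b - ?g))" .
  have "?g \<le> b"
    using pos by (simp add: dvd_imp_le)
  \<comment> \<open>This yields \<open>q + r \<le> q r + 1 \<le> c + 1\<close>, so the subtraction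
    in \<open>c + 1 - q - r\<close> does not truncate.\<close>
  have "0 \<le> (int q - 1) * (int r - 1)"
    using q_pos r_pos by simp
  then have "int q + int r \<le> int (q * r) + 1"
    by (simp add: algebra_simps)
  moreover have "q * r \<le> c"
    using c_eq p_pos by (metis mult.assoc mult_le_mono1 mult_1 Suc_leI One_nat_def)
  ultimately have "q + r \<le> c + 1" by linarith
  with * \<open>?g \<le> b\<close> show ?thesis
    using pos unfolding N_def q_def r_def gcd.commute [of c a] by linarith
qed

text \<open>The hypothesis \<open>sums\<close> says that the generating polynomial \<open>H\<close>
  of \<open>f\<close> is a multiple of \<open>geo_poly 1 n\<close> modulo \<open>x^n - 1\<close>, so
  \<open>H\<close> vanishes at the nontrivial \<open>n\<close>-th roots and \<open>H(1) = I\<close>.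
  Subtracting the right multiple of \<open>P * h2_poly\<close> leaves degree below \<open>N\<close>
  and \<open>N\<close> roots, hence 0.\<close>

lemma fiber_eq_multiple:
  fixes f :: "nat \<Rightarrow> real"
  assumes outside: "\<And>k. k \<ge> N \<Longrightarrow> f k = 0"
    and sums: "\<And>n j. n \<in> {a, b, c} \<Longrightarrow> j < n \<Longrightarrow> (\<Sum>k<N. f (j + n * k)) = I / n"
  shows "f k = I / poly (P * h2_poly) 1 * coeff (P * h2_poly) k"
proof -
  define H where "H = (\<Sum>k<N. monom (f k) k)"
  have coeff_H: "coeff H k = f k" for k
    using outside by (auto simp: H_def coeff_sum not_less)
  have N: "N > 0" using degree_less by simp
  have H_sum: "poly (complex_poly H) z = (\<Sum>j<n. z ^ j) * of_real (I / n)"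
    if n: "n \<in> {a, b, c}" and z: "z ^ n = 1" for n z
  proof -
    have "poly (complex_poly H) z = (\<Sum>k<N. of_real (f k) * z ^ k)"
      by (simp add: H_def complex_poly_sum map_poly_monom poly_sum poly_monom)
    \<comment> \<open>Padding with zeros up to \<open>n * N\<close> makes the range a union of
      \<open>n\<close> full residue classes; on each class \<open>z^k\<close> is constant.\<close>
    also have "\<dots> = (\<Sum>k<n * N. of_real (f k) * z ^ k)"
      using n pos outside by (intro sum.mono_neutral_left) (auto intro: less_le_trans)
    also have "\<dots> = (\<Sum>j<n. \<Sum>k<N. of_real (f (j + n * k)) * z ^ (j + n * k))"
      by (rule sum_residue_classes)
    also have "\<dots> = (\<Sum>j<n. z ^ j * of_real (\<Sum>k<N. f (j + n * k)))"
      by (simp add: power_add power_mult z sum_distrib_left mult.commute [of "z ^ _"])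
    also have "\<dots> = (\<Sum>j<n. z ^ j * of_real (I / n))"
      using sums [OF n] by (intro sum.cong) auto
    finally show ?thesis by (simp only: sum_distrib_right)
  qed
  let ?l = "I / poly (P * h2_poly) 1"
  have "H - smult ?l (P * h2_poly) = 0"
  proof (rule real_poly_eq_0_if_vanishing_on_roots_of_unity [OF pos gcd_one])
    have "degree H < N"
      using N outside by (intro degree_lessI) (auto simp: coeff_H)
    moreover have "degree (smult ?l (P * h2_poly)) < N"
      using degree_less degree_smult_le le_less_trans by blast
    ultimately show "degree (H - smult ?l (P * h2_poly)) < a + b + c + 1 - gcd a b - gcd b c - gcd c a"
      unfolding N_def by (rule degree_diff_less)
  next
    fix z :: complex
    assume "z ^ a = 1 \<or> z ^ b = 1 \<or> z ^ c = 1"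
    then obtain n where n: "n \<in> {a, b, c}" "z ^ n = 1" by blast
    show "poly (complex_poly (H - smult ?l (P * h2_poly))) z = 0"
    proof (cases "z = 1")
      \<comment> \<open>The factor \<open>?l\<close> is chosen so that both polynomials take the
        value \<open>I\<close> at 1.\<close>
      case True
      have "poly (complex_poly (P * h2_poly)) 1 = of_real (poly (P * h2_poly) 1)"
        by (simp add: poly_altdef degree_complex_poly coeff_map_poly)
      moreover have "poly (complex_poly H) 1 = of_real I"
        using H_sum [OF n(1), of 1] n pos by auto
      ultimately show ?thesis
        using True poly_one_nonzero by (simp add: complex_poly_diff complex_poly_smult del: poly_mult)
    next
      case False
      then have "poly (complex_poly H) z = 0"
        using H_sum [OF n] poly_geo_poly_root_of_unity [OF n(2)] by (simp add: poly_geo_poly)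
      with False quotient_h2_poly_root [OF \<open>z ^ a = 1 \<or> z ^ b = 1 \<or> z ^ c = 1\<close>] show ?thesis
        by (simp add: complex_poly_diff complex_poly_smult)
    qed
  qed
  then show ?thesis
    using coeff_H [of k] by (metis coeff_smult eq_iff_diff_eq_0)
qed

end

end

subsection \<open>Orthogonality to periodic functions\<close>

lemma integrable_bounded_mult:
  fixes u g :: "'a \<Rightarrow> real"
  assumes "integrable M g" "u \<in> borel_measurable M" "\<And>t. \<bar>u t\<bar> \<le> C"
  shows "integrable M (\<lambda>t. u t * g t)"
proof (rule Bochner_Integration.integrable_bound)
  show "integrable M (\<lambda>t. C * g t)" using assms(1) by simp
  show "(\<lambda>t. u t * g t) \<in> borel_measurable M" using assms by simp
  show "AE t in M. norm (u t * g t) \<le> norm (C * g t)"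
    using order_trans [OF assms(3) abs_ge_self] by (intro AE_I2) (simp add: abs_mult mult_right_mono)
qed

text \<open>Provides test functions: boundedness gives local square integrability, and for Borel
  functions the integrals over \<open>lborel\<close> and \<open>lebesgue\<close> agree.\<close>

lemma of_real_in_X:
  fixes u :: "real \<Rightarrow> real"
  assumes u: "u \<in> borel_measurable borel" and bound: "\<And>t. \<bar>u t\<bar> \<le> C"
    and per: "\<And>t. u (t + S) = u t" and mean: "(LINT t:{0..S}|lborel. u t) = 0"
  shows "(\<lambda>t. complex_of_real (u t)) \<in> X S"
proof -
  note [measurable] = u
  have "(\<lambda>t. complex_of_real (u t)) \<in> L2 {a..b}" for a b
  proof -
    have "set_borel_measurable lebesgue {a..b} (\<lambda>t. complex_of_real (u t))"
      unfolding set_borel_measurable_def by (rule measurable_completion) measurable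
    moreover have "integrable lborel (\<lambda>t. indicator {a..b} t *\<^sub>R (u t)\<^sup>2)"
    proof (rule Bochner_Integration.integrable_bound)
      show "integrable lborel (\<lambda>t. C\<^sup>2 * indicator {a..b} t)"
        by (intro integrable_mult_right integrable_real_indicator) (auto simp: emeasure_lborel_Icc_eq)
      show "AE t in lborel. norm (indicator {a..b} t *\<^sub>R (u t)\<^sup>2) \<le> norm (C\<^sup>2 * indicator {a..b} t)"
        using bound power_mono [OF bound abs_ge_zero, where n = 2] by (auto split: split_indicator)
    qed measurable
    ultimately show ?thesis
      unfolding L2_def set_integrable_def by (simp add: integrable_completion)
  qed
  moreover have "(LINT t:{0..S}|lebesgue. complex_of_real (u t)) = 0"
  proof -
    have "(LINT t:{0..S}|lebesgue. complex_of_real (u t)) = (LINT t:{0..S}|lborel. complex_of_real (u t))"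
      unfolding set_lebesgue_integral_def by (rule integral_completion) measurable
    then show ?thesis using mean by (simp add: set_integral_complex_of_real)
  qed
  ultimately show ?thesis
    by (simp add: X_def per)
qed

text \<open>The support is cut into \<open>K\<close> intervals of length \<open>S\<close>, and each
  is translated back to the first one, which leaves \<open>u\<close> unchanged.\<close>

lemma integral_periodic_mult:
  fixes g u :: "real \<Rightarrow> real" and S :: real and K :: nat
  assumes g: "integrable lborel g" and supp: "\<And>t. t \<notin> {0..<K * S} \<Longrightarrow> g t = 0" and "S > 0"
    and u: "u \<in> borel_measurable borel" "\<And>t. \<bar>u t\<bar> \<le> C" and per: "\<And>t. u (t + S) = u t"
  shows "(LINT t|lborel. u t * g t) = (LINT t:{0..<S}|lborel. u t * (\<Sum>k<K. g (t + k * S)))"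
proof -
  note [measurable] = u(1)
  have per': "u (t + real k * S) = u t" for t k
  proof (induction k)
    case (Suc k)
    have "t + real (Suc k) * S = (t + real k * S) + S" by (simp add: algebra_simps)
    with Suc per [of "t + real k * S"] show ?case by (simp only:)
  qed simp
  have ug: "integrable lborel (\<lambda>t. u t * g t)"
    by (rule integrable_bounded_mult [OF g _ u(2)]) simp
  have shift: "indicator {k * S..<(1 + real k) * S} (t + k * S) = (indicator {0..<S} t :: real)" for k :: nat and t
    by (auto simp: indicator_def algebra_simps)
  have split: "u t * g t = (\<Sum>k<K. indicator {k * S..<(1 + real k) * S} t * (u t * g t))" for t
  proof (cases "t \<in> {0..<K * S}")
    case True
    \<comment> \<open>The index of the only interval of length \<open>S\<close> that contains
      \<open>t\<close>.\<close>
    define n where "n = nat \<lfloor>t / S\<rfloor>"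
    have n: "t \<in> {k * S..<(1 + real k) * S} \<longleftrightarrow> k = n" for k :: nat
    proof -
      have "t \<in> {k * S..<(1 + real k) * S} \<longleftrightarrow> real k \<le> t / S \<and> t / S < real k + 1"
        using \<open>S > 0\<close> by (simp add: pos_le_divide_eq pos_divide_less_eq add.commute)
      also have "\<dots> \<longleftrightarrow> \<lfloor>t / S\<rfloor> = int k"
        by (simp add: floor_eq_iff)
      also have "\<dots> \<longleftrightarrow> k = n"
        using True \<open>S > 0\<close> by (auto simp: n_def)
      finally show ?thesis .
    qed
    have "real n * S \<le> t" using n [of n] by simp
    with True have "real n * S < real K * S" by simp
    then have "n < K" using \<open>S > 0\<close> by simp
    have "(\<Sum>k<K. indicator {k * S..<(1 + real k) * S} t * (u t * g t)) = (\<Sum>k<K. if k = n then u t * g t else 0)"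
      by (intro sum.cong refl) (use n in \<open>auto simp: indicator_def\<close>)
    then show ?thesis using \<open>n < K\<close> by simp
  qed (simp add: supp)
  have int: "integrable lborel (\<lambda>t. indicator {k * S..<(1 + real k) * S} t * (u t * g t))" for k :: nat
    using integrable_mult_indicator [OF _ ug, of "{k * S..<(1 + real k) * S}"] by simp
  have piece: "(LINT t|lborel. indicator {k * S..<(1 + real k) * S} t * (u t * g t))
      = (LINT t|lborel. indicator {0..<S} t * (u t * g (t + k * S)))" for k :: nat
    by (subst lborel_integral_real_affine [of 1 _ "k * S"])
      (simp_all add: shift per' add.commute [of "_ * S"])
  have int': "integrable lborel (\<lambda>t. indicator {0..<S} t * (u t * g (t + k * S)))" for k :: nat
    using lborel_integrable_real_affine [OF int [of k], of 1 "k * S"]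
    by (simp add: shift per' add.commute [of "_ * S"])
  have "(LINT t|lborel. u t * g t) = (\<Sum>k<K. LINT t|lborel. indicator {k * S..<(1 + real k) * S} t * (u t * g t))"
    by (subst split, rule Bochner_Integration.integral_sum) (rule int)
  also have "\<dots> = (LINT t|lborel. (\<Sum>k<K. indicator {0..<S} t * (u t * g (t + k * S))))"
    unfolding piece by (rule Bochner_Integration.integral_sum [symmetric]) (rule int')
  finally show ?thesis
    by (simp add: set_lebesgue_integral_def sum_distrib_left)
qed

definition orth_periodic :: "real \<Rightarrow> (real \<Rightarrow> real) \<Rightarrow> bool" where
  "orth_periodic S g \<longleftrightarrow>
    (\<forall>u C. u \<in> borel_measurable borel \<longrightarrow> (\<forall>t. \<bar>u t\<bar> \<le> C) \<longrightarrow> (\<forall>t. u (t + S) = u t) \<longrightarrow>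
      (LINT t:{0..S}|lborel. u t) = 0 \<longrightarrow> (LINT t|lborel. u t * g t) = 0)"

text \<open>The test function \<open>u\<close> is the periodic extension of the indicator of the set \<open>E\<close> where the
  periodization exceeds its mean, shifted to mean zero.  Being bounded, it needs no square
  integrability of the periodization.\<close>

lemma periodization_constant:
  fixes g :: "real \<Rightarrow> real" and S :: real and K :: nat
  assumes g: "integrable lborel g" and supp: "\<And>t. t \<notin> {0..<K * S} \<Longrightarrow> g t = 0" and "S > 0"
    and orth: "orth_periodic S g"
  shows "AE t in lborel. t \<in> {0..<S} \<longrightarrow> (\<Sum>k<K. g (t + k * S)) = (LINT t|lborel. g t) / S"
proof -
  have [measurable]: "g \<in> borel_measurable borel"
    using borel_measurable_integrable [OF g] by simp
  define p where "p t = (\<Sum>k<K. g (t + k * S))" for t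
  define m where "m = (LINT t|lborel. g t) / S"
  have [measurable]: "p \<in> borel_measurable borel"
    unfolding p_def by measurable
  have "integrable lborel (\<lambda>t. g (t + k * S))" for k :: nat
    using lborel_integrable_real_affine [OF g, of 1 "k * S"] by (simp add: add.commute)
  then have p: "integrable lborel p"
    unfolding p_def by (intro Bochner_Integration.integrable_sum)
  define J where "J = {0..<S}"
  have J: "J \<in> sets borel" "emeasure lborel J < \<infinity>" "measure lborel J = S"
    using \<open>S > 0\<close> by (simp_all add: J_def)
  have int_p: "(LINT t|lborel. indicator J t * p t) = m * S"
    using integral_periodic_mult [OF g supp \<open>S > 0\<close>, where u = "\<lambda>_. 1" and C = 1] \<open>S > 0\<close>
    by (simp add: p_def m_def J_def set_lebesgue_integral_def)
  define E where "E = {t \<in> J. m < p t}"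
  have E: "E \<in> sets borel"
    unfolding E_def J_def by measurable
  have "emeasure lborel E \<le> emeasure lborel J"
    by (intro emeasure_mono) (auto simp: E_def J_def)
  then have E': "emeasure lborel E < \<infinity>"
    using J by simp
  define e where "e = measure lborel E"
  \<comment> \<open>All integer translates are taken, so that \<open>U\<close> is periodic on the
    whole line; \<open>U_E\<close> shows that within \<open>J\<close> it is still just
    \<open>E\<close>.\<close>
  define U where "U = {t. \<exists>k::int. t - k * S \<in> E}"
  have U: "U \<in> sets borel"
    unfolding U_def using E by measurable
  have U_per: "t + S \<in> U \<longleftrightarrow> t \<in> U" for t
  proof -
    have shift: "t + S - real_of_int k * S = t - real_of_int (k - 1) * S" for k
      by (simp add: algebra_simps)
    show ?thesis
    proof
      assume "t + S \<in> U"
      then obtain k where "t + S - real_of_int k * S \<in> E" by (auto simp: U_def)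
      then show "t \<in> U" unfolding U_def shift by blast
    next
      assume "t \<in> U"
      then obtain k where "t - real_of_int k * S \<in> E" by (auto simp: U_def)
      then have "t + S - real_of_int (k + 1) * S \<in> E" unfolding shift by simp
      then show "t + S \<in> U" unfolding U_def by blast
    qed
  qed
  have U_E: "t \<in> U \<longleftrightarrow> t \<in> E" if "t \<in> J" for t
  proof
    assume "t \<in> U"
    then obtain k :: int where k: "t - k * S \<in> E" by (auto simp: U_def)
    then have "t - k * S \<in> J" by (simp add: E_def)
    with that have "real_of_int k * S < 1 * S" "(-1) * S < real_of_int k * S"
      by (simp_all only: J_def atLeastLessThan_iff mult_1 mult_minus_left) linarith+
    then have "k = 0"
      unfolding mult_less_cancel_right_pos [OF \<open>S > 0\<close>] by linarith
    with k show "t \<in> E" by simp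
  next
    assume "t \<in> E"
    then show "t \<in> U" by (auto simp: U_def intro: exI [of _ 0])
  qed
  define u where "u t = indicator U t - e / S" for t
  have u_meas [measurable]: "u \<in> borel_measurable borel"
    unfolding u_def using U by measurable
  have u_bound: "\<bar>u t\<bar> \<le> 1 + \<bar>e / S\<bar>" for t
  proof -
    have *: "\<bar>i - x\<bar> \<le> 1 + \<bar>x\<bar>" if "i \<in> {0, 1}" for i x :: real
      using that by auto
    show ?thesis unfolding u_def by (rule *) (simp add: indicator_def)
  qed
  have u_per: "u (t + S) = u t" for t
    using U_per by (auto simp: u_def indicator_def)
  have u_J: "indicator J t * u t = indicator E t - e / S * indicator J t" for t
    using U_E by (auto simp: u_def indicator_def E_def)
  have ints: "integrable lborel (indicator E :: real \<Rightarrow> real)" "integrable lborel (indicator J :: real \<Rightarrow> real)"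
    "integrable lborel (\<lambda>t. indicator E t * p t)" "integrable lborel (\<lambda>t. indicator J t * p t)"
    using E E' J integrable_mult_indicator [OF _ p, of E] integrable_mult_indicator [OF _ p, of J]
    by (auto intro!: integrable_real_indicator)
  have "(LINT t:{0..S}|lborel. u t) = (LINT t|lborel. indicator J t * u t)"
    unfolding set_lebesgue_integral_def
  proof (rule integral_cong_AE)
    \<comment> \<open>The two intervals differ only in the endpoint \<open>S\<close>.\<close>
    show "AE t in lborel. indicator {0..S} t *\<^sub>R u t = indicator J t * u t"
      using AE_lborel_singleton [of S] by eventually_elim (auto simp: J_def indicator_def)
  qed (use J in measurable)
  also have "\<dots> = e - e / S * S"
    unfolding u_J using ints J by (simp add: e_def)
  finally have "(LINT t:{0..S}|lborel. u t) = 0"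
    using \<open>S > 0\<close> by simp
  then have "0 = (LINT t|lborel. u t * g t)"
    by (intro orth [unfolded orth_periodic_def, rule_format, symmetric, where u = u, OF u_meas u_bound u_per])
  also have "\<dots> = (LINT t:{0..<S}|lborel. u t * p t)"
    unfolding p_def
    by (rule integral_periodic_mult [where u = u, OF g supp \<open>S > 0\<close> u_meas u_bound u_per])
  also have "\<dots> = (LINT t|lborel. indicator E t * p t - e / S * (indicator J t * p t))"
    unfolding set_lebesgue_integral_def J_def [symmetric]
  proof (intro Bochner_Integration.integral_cong refl)
    fix t
    have "indicator J t *\<^sub>R (u t * p t) = (indicator J t * u t) * p t"
      by simp
    then show "indicator J t *\<^sub>R (u t * p t) = indicator E t * p t - e / S * (indicator J t * p t)"
      by (simp only: u_J left_diff_distrib mult.assoc)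
  qed
  also have "\<dots> = (LINT t|lborel. indicator E t * p t) - m * e"
    using \<open>S > 0\<close> by (simp add: int_p ints)
  also have "\<dots> = (LINT t|lborel. indicator E t * p t - m * indicator E t)"
    by (simp add: ints e_def)
  finally have "(LINT t|lborel. indicator E t * p t - m * indicator E t) = 0" ..
  moreover have "integrable lborel (\<lambda>t. indicator E t * p t - m * indicator E t)"
    by (simp add: ints)
  moreover have "AE t in lborel. 0 \<le> indicator E t * p t - m * indicator E t"
    by (auto simp: E_def indicator_def)
  ultimately have "AE t in lborel. indicator E t * p t - m * indicator E t = 0"
    using integral_nonneg_eq_0_iff_AE by blast
  \<comment> \<open>On \<open>E\<close> the integrand is positive, so \<open>E\<close> is a null set
    and \<open>p \<le> m\<close> almost everywhere on \<open>J\<close>. Since \<open>p\<close> has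
    mean \<open>m\<close> on \<open>J\<close>, equality follows.\<close>
  then have le: "AE t in lborel. 0 \<le> m * indicator J t - indicator J t * p t"
    by eventually_elim (auto simp: E_def indicator_def split: if_splits)
  have int: "integrable lborel (\<lambda>t. m * indicator J t - indicator J t * p t)"
    by (simp add: ints)
  have "(LINT t|lborel. m * indicator J t - indicator J t * p t) = m * S - m * S"
    using J by (simp add: int_p ints)
  then have "AE t in lborel. m * indicator J t - indicator J t * p t = 0"
    using integral_nonneg_eq_0_iff_AE [OF int le] by simp
  then show ?thesis
    by eventually_elim (auto simp: J_def p_def m_def)
qed

text \<open>Passes from Lebesgue to Borel measurability, which translation arguments in
  \<open>lborel\<close> require. On a bounded interval square integrability implies
  integrability.\<close>

lemma is_h3_borel_representative:
  assumes h: "is_h3 T1 T2 T3 h"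
  obtains g :: "real \<Rightarrow> real" where "integrable lborel g" "AE t in lborel. h t = g t"
    "\<And>t. t \<notin> {0<..<T123 T1 T2 T3} \<Longrightarrow> g t = 0"
    "\<And>S. S \<in> {real T1, real T2, real T3} \<Longrightarrow> orth_periodic S g"
proof -
  define D where "D = {0<..<T123 T1 T2 T3}"
  have h_out: "h t = 0" if "t \<notin> D" for t
    using h that by (simp add: is_h3_def D_def)
  have mem: "(\<lambda>t. complex_of_real (h t)) \<in> L2 D"
    and orth: "\<And>u. u \<in> X_sum3 T1 T2 T3 \<Longrightarrow> (LINT t:D|lebesgue. u t * cnj (complex_of_real (h t))) = 0"
    using h by (auto simp: is_h3_def orth_compl_def D_def)
  have "(\<lambda>t. indicator D t *\<^sub>R complex_of_real (h t)) \<in> borel_measurable lebesgue"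
    using mem unfolding L2_def set_borel_measurable_def by simp
  then have "(\<lambda>t. Re (indicator D t *\<^sub>R complex_of_real (h t))) \<in> borel_measurable lebesgue"
    by (rule measurable_compose [OF _ borel_measurable_Re])
  also have "(\<lambda>t. Re (indicator D t *\<^sub>R complex_of_real (h t))) = h"
    using h_out by (auto simp: fun_eq_iff indicator_def)
  finally have h_meas: "h \<in> borel_measurable lebesgue" .
  then obtain g' where g' [measurable]: "g' \<in> borel_measurable borel" and "AE t in lborel. h t = g' t"
    using completion_ex_borel_measurable_real [of h lborel] by auto
  \<comment> \<open>The cut-off makes \<open>g\<close> vanish everywhere outside \<open>D\<close>,
    not merely almost everywhere.\<close>
  define g where "g t = indicator D t * g' t" for t
  have [measurable]: "g \<in> borel_measurable borel"
    unfolding g_def D_def by measurable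
  have eq: "AE t in lborel. h t = g t"
    using \<open>AE t in lborel. h t = g' t\<close>
    by eventually_elim (use h_out in \<open>auto simp: g_def indicator_def\<close>)
  have g_out: "g t = 0" if "t \<notin> D" for t
    using that by (simp add: g_def)
  have "integrable lebesgue (\<lambda>t. (h t)\<^sup>2)"
  proof -
    have "integrable lebesgue (\<lambda>t. indicator D t *\<^sub>R (cmod (complex_of_real (h t)))\<^sup>2)"
      using mem unfolding L2_def set_integrable_def by simp
    also have "(\<lambda>t. indicator D t *\<^sub>R (cmod (complex_of_real (h t)))\<^sup>2) = (\<lambda>t. (h t)\<^sup>2)"
      using h_out by (auto simp: fun_eq_iff indicator_def)
    finally show ?thesis .
  qed
  moreover have "AE t in lebesgue. (h t)\<^sup>2 = (g t)\<^sup>2"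
    using AE_completion [OF eq] by eventually_elim simp
  moreover have "(\<lambda>t. (g t)\<^sup>2) \<in> borel_measurable lebesgue"
    by (rule measurable_completion) measurable
  ultimately have "integrable lebesgue (\<lambda>t. (g t)\<^sup>2)"
    by (intro integrable_cong_AE_imp [where g = "\<lambda>t. (h t)\<^sup>2" and f = "\<lambda>t. (g t)\<^sup>2"])
  then have sq: "integrable lborel (\<lambda>t. (g t)\<^sup>2)"
    by (simp add: integrable_completion)
  have "bounded D" "D \<in> sets lborel"
    unfolding D_def by (metis bounded_box box_real(1)) simp
  then have D: "integrable lborel (indicator D :: real \<Rightarrow> real)"
    by (intro integrable_real_indicator emeasure_bounded_finite)
  have int: "integrable lborel g"
  proof (rule Bochner_Integration.integrable_bound)
    show "integrable lborel (\<lambda>t. indicator D t + (g t)\<^sup>2)"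
      using sq D by simp
    have "\<bar>x\<bar> \<le> 1 + x\<^sup>2" for x :: real
    proof -
      have "0 \<le> (\<bar>x\<bar> - 1)\<^sup>2" by simp
      then have "2 * \<bar>x\<bar> \<le> 1 + x\<^sup>2" by (simp add: power2_diff)
      then show ?thesis by linarith
    qed
    then show "AE t in lborel. norm (g t) \<le> norm (indicator D t + (g t)\<^sup>2)"
      using g_out by (intro AE_I2) (auto simp: indicator_def)
  qed measurable
  have "orth_periodic S g" if S: "S \<in> {real T1, real T2, real T3}" for S
    unfolding orth_periodic_def
  proof (intro allI impI)
    fix u :: "real \<Rightarrow> real" and C
    assume u [measurable]: "u \<in> borel_measurable borel"
      and u': "\<forall>t. \<bar>u t\<bar> \<le> C" "\<forall>t. u (t + S) = u t" "(LINT t:{0..S}|lborel. u t) = 0"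
    \<comment> \<open>Taking zero for the other two summands places each single \<open>X S\<close>
      inside \<open>X_sum3\<close>.\<close>
    have zero: "(\<lambda>t. 0) \<in> X S'" for S'
      using of_real_in_X [of "\<lambda>_. 0" 0 S'] by simp
    have "(\<lambda>t. complex_of_real (u t)) \<in> X_sum3 T1 T2 T3"
    proof -
      have sum: "(\<lambda>t. v1 t + v2 t + v3 t) \<in> X_sum3 T1 T2 T3"
        if "v1 \<in> X T1" "v2 \<in> X T2" "v3 \<in> X T3" for v1 v2 v3
        using that unfolding X_sum3_def by blast
      consider "S = T1" | "S = T2" | "S = T3" using S by blast
      then show ?thesis
      proof cases
        case 1
        with sum [OF _ zero zero] of_real_in_X [where u = u, OF u u'(1) [rule_format] u'(2) [rule_format] u'(3)] show ?thesis by simp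
      next
        case 2
        with sum [OF zero _ zero] of_real_in_X [where u = u, OF u u'(1) [rule_format] u'(2) [rule_format] u'(3)] show ?thesis by simp
      next
        case 3
        with sum [OF zero zero] of_real_in_X [where u = u, OF u u'(1) [rule_format] u'(2) [rule_format] u'(3)] show ?thesis by simp
      qed
    qed
    then have "0 = (LINT t:D|lebesgue. complex_of_real (u t) * cnj (complex_of_real (h t)))"
      using orth by simp
    also have "\<dots> = (LINT t|lebesgue. complex_of_real (u t * g t))"
      unfolding set_lebesgue_integral_def
    proof (rule integral_cong_AE)
      show "AE t in lebesgue. indicator D t *\<^sub>R (complex_of_real (u t) * cnj (complex_of_real (h t))) = complex_of_real (u t * g t)"
        using AE_completion [OF eq] by eventually_elim (use g_out in \<open>auto simp: indicator_def\<close>)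
      have [measurable]: "u \<in> borel_measurable lebesgue" "h \<in> borel_measurable lebesgue" "D \<in> sets lebesgue"
        using h_meas u by (auto simp: D_def measurable_completion)
      show "(\<lambda>t. indicator D t *\<^sub>R (complex_of_real (u t) * cnj (complex_of_real (h t)))) \<in> borel_measurable lebesgue"
        unfolding complex_cnj_complex_of_real by measurable
      show "(\<lambda>t. complex_of_real (u t * g t)) \<in> borel_measurable lebesgue"
        by (rule measurable_completion) measurable
    qed
    also have "\<dots> = (LINT t|lborel. complex_of_real (u t * g t))"
      by (rule integral_completion) measurable
    finally show "(LINT t|lborel. u t * g t) = 0"
      by (metis integral_complex_of_real of_real_eq_0_iff)
  qed
  with int eq g_out show thesis
    by (intro that [of g]) (auto simp: D_def)
qed

subsection \<open>Step functions on a grid\<close>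

text \<open>On \<open>[d k, d (k + 1))\<close> the function is constant with value
  \<open>coeff p k\<close>. Thus step functions become polynomials, and translation by
  \<open>d n\<close> becomes multiplication by \<open>x^n\<close>.\<close>

definition step_poly :: "nat \<Rightarrow> (real \<Rightarrow> real) \<Rightarrow> real poly \<Rightarrow> bool" where
  "step_poly d \<phi> p \<longleftrightarrow> (\<forall>t<0. \<phi> t = 0) \<and> (\<forall>s\<in>{0..<real d}. \<forall>k. \<phi> (s + real d * real k) = coeff p k)"

lemma less_imp_mult_Suc_le: "k < n \<Longrightarrow> real d + real d * real k \<le> real d * real n"
  using mult_left_mono [of "real k + 1" "real n" "real d"] by (simp add: algebra_simps)

lemma step_poly_shift:
  assumes "step_poly d \<phi> p"
  shows "step_poly d (\<lambda>t. \<phi> (t - real d * real n)) (monom 1 n * p)"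
  unfolding step_poly_def
proof (intro conjI ballI allI impI)
  fix t :: real assume "t < 0"
  then have "t - real d * real n < 0"
    using mult_nonneg_nonneg [of "real d" "real n"] by linarith
  with assms show "\<phi> (t - real d * real n) = 0"
    by (simp add: step_poly_def)
next
  fix s k assume s: "s \<in> {0..<real d}"
  show "\<phi> (s + real d * real k - real d * real n) = coeff (monom 1 n * p) k"
  proof (cases "k < n")
    case True
    then have "s + real d * real k - real d * real n < 0"
      using less_imp_mult_Suc_le [OF True, of d] s by simp
    with assms True show ?thesis by (simp add: step_poly_def coeff_monom_mult)
  next
    case False
    then have "s + real d * real k - real d * real n = s + real d * real (k - n)"
      by (simp add: of_nat_diff algebra_simps)
    moreover have "\<phi> (s + real d * real (k - n)) = coeff p (k - n)"
      using assms s unfolding step_poly_def by blast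
    moreover have "coeff (monom 1 n * p) k = coeff p (k - n)"
      using False by (simp add: coeff_monom_mult)
    ultimately show ?thesis by (simp only:)
  qed
qed

lemma step_poly_sum:
  "(\<And>i. i \<in> A \<Longrightarrow> step_poly d (\<phi> i) (p i)) \<Longrightarrow> step_poly d (\<lambda>t. \<Sum>i\<in>A. \<phi> i t) (\<Sum>i\<in>A. p i)"
  by (simp add: step_poly_def coeff_sum)

lemma step_poly_smult: "step_poly d \<phi> p \<Longrightarrow> step_poly d (\<lambda>t. c * \<phi> t) (smult c p)"
  by (simp add: step_poly_def)

lemma step_poly_h1: "step_poly d (h1 (d * a)) (geo_poly 1 a)"
  unfolding step_poly_def
proof (intro conjI ballI allI impI)
  show "h1 (d * a) t = 0" if "t < 0" for t
    using that by (simp add: h1_def)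
  fix s k assume s: "s \<in> {0..<real d}"
  have "s + real d * real k < real d * real a \<longleftrightarrow> k < a"
  proof
    assume "k < a"
    with less_imp_mult_Suc_le [OF this, of d] s show "s + real d * real k < real d * real a" by simp
  next
    assume "s + real d * real k < real d * real a"
    with s have "real d * real k < real d * real a"
      unfolding atLeastLessThan_iff by linarith
    then show "k < a" by (meson linorder_not_less mult_left_mono of_nat_0_le_iff of_nat_le_iff)
  qed
  with s show "h1 (d * a) (s + real d * real k) = coeff (geo_poly 1 a) k"
    by (simp add: h1_def indicator_def coeff_geo_poly_one [simplified])
qed

lemma (in three_periods) step_poly_h2:
  assumes "d > 0"
  shows "step_poly d (h2 (d * a) (d * b)) h2_poly"
proof -
  have "step_poly d (\<lambda>t. \<Sum>j<b div gcd a b. h1 (d * a) (t - real d * real (gcd a b * j)))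
     (\<Sum>j<b div gcd a b. monom 1 (gcd a b * j) * geo_poly 1 a)"
    by (intro step_poly_sum step_poly_shift step_poly_h1)
  also have "(\<lambda>t. \<Sum>j<b div gcd a b. h1 (d * a) (t - real d * real (gcd a b * j))) = h2 (d * a) (d * b)"
  proof -
    have "gcd (d * a) (d * b) = d * gcd a b"
      by (simp only: gcd_mult_distrib_nat)
    then show ?thesis
      using assms by (simp add: fun_eq_iff h2_def mult_ac)
  qed
  also have "(\<Sum>j<b div gcd a b. monom 1 (gcd a b * j) * geo_poly 1 a) = h2_poly"
    unfolding h2_poly_def geo_poly_def [of "gcd a b"] by (simp add: sum_distrib_left mult.commute)
  finally show ?thesis .
qed

text \<open>A linear combination of translates is a convolution, that is, a product of polynomials;
  this is how the sum in the theorem becomes \<open>P * h2_poly\<close>.\<close>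

lemma step_poly_coeff_sum:
  assumes "step_poly d \<phi> p" "degree P \<le> n"
  shows "step_poly d (\<lambda>t. \<Sum>j\<le>n. coeff P j * \<phi> (t - real j * real d)) (P * p)"
proof -
  have "P = (\<Sum>j\<le>n. monom (coeff P j) j)"
    using assms(2) by (simp add: poly_as_sum_of_monoms')
  also have "\<dots> = (\<Sum>j\<le>n. smult (coeff P j) (monom 1 j))"
    by (simp add: smult_monom)
  finally have "P * p = (\<Sum>j\<le>n. smult (coeff P j) (monom 1 j)) * p"
    by (rule arg_cong)
  then have "P * p = (\<Sum>j\<le>n. smult (coeff P j) (monom 1 j * p))"
    by (simp only: sum_distrib_right mult_smult_left)
  moreover have "step_poly d (\<lambda>t. \<Sum>j\<le>n. coeff P j * \<phi> (t - real d * real j)) (\<Sum>j\<le>n. smult (coeff P j) (monom 1 j * p))"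
    by (intro step_poly_sum step_poly_smult step_poly_shift assms)
  ultimately show ?thesis by (simp add: mult.commute)
qed

section \<open>From almost every fiber back to functions on the line\<close>

lemma (in three_periods) gcd3_eq: "gcd3 (d * a) (d * b) (d * c) = d"
proof -
  have "gcd3 (d * a) (d * b) (d * c) = d * gcd a (gcd b c)"
    by (simp only: gcd3_def gcd_mult_distrib_nat)
  with gcd_one show ?thesis by simp
qed

lemma (in three_periods) T123_eq:
  "T123 (d * a) (d * b) (d * c) = real d * real N"
proof -
  have "gcd a b \<le> a" "gcd b c \<le> b" "gcd c a \<le> c"
    using pos by (auto intro: dvd_imp_le)
  then have "real N = real a + real b + real c + 1 - real (gcd a b) - real (gcd b c) - real (gcd c a)"
    unfolding N_def by (simp add: of_nat_diff)
  moreover have "gcd (d * m) (d * n) = d * gcd m n" for m n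
    by (simp only: gcd_mult_distrib_nat)
  ultimately show ?thesis
    by (simp only: T123_def gcd3_eq of_nat_mult) (simp add: algebra_simps)
qed

text \<open>\<open>periodization_constant\<close> supplies the hypotheses of
  \<open>fiber_eq_multiple\<close> on almost every fiber. The constant \<open>I\<close> comes from
  the integral of \<open>g\<close>, so the factor \<open>l\<close> is the same for all
  fibers.\<close>

lemma (in three_periods) h3_multiple:
  assumes h: "is_h3 (d * a) (d * b) (d * c) h" and "d > 0"
    and P: "geo_poly 1 (p * q * r) = P * geo_poly 1 q * geo_poly 1 r"
    and \<phi>: "step_poly d \<phi> (P * h2_poly)"
  shows "\<exists>l. l \<noteq> 0 \<and> (AE t in lebesgue. l * h t = \<phi> t)"
proof -
  obtain g :: "real \<Rightarrow> real" where g: "integrable lborel g" and eq: "AE t in lborel. h t = g t"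
    and out: "\<And>t. t \<notin> {0<..<T123 (d * a) (d * b) (d * c)} \<Longrightarrow> g t = 0"
    and orth: "\<And>S. S \<in> {real (d * a), real (d * b), real (d * c)} \<Longrightarrow> orth_periodic S g"
    using is_h3_borel_representative [OF h] by blast
  have [measurable]: "g \<in> borel_measurable borel"
    using borel_measurable_integrable [OF g] by simp
  define I where "I = (LINT t|lborel. g t) / d"
  define l where "l = I / poly (P * h2_poly) 1"
  have sums: "AE s in lborel. s \<in> {0..<real d} \<longrightarrow>
      (\<forall>j<n. (\<Sum>k<N. g (s + real d * real (j + n * k))) = I / n)" if n: "n \<in> {a, b, c}" for n
  proof -
    have "n > 0" using n pos by auto
    have "N \<le> N * n" using \<open>n > 0\<close> by simp
    then have "real N \<le> real (N * n)" by (simp only: of_nat_le_iff)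
    then have "real d * real N \<le> real d * real (N * n)"
      by (intro mult_left_mono of_nat_0_le_iff)
    \<comment> \<open>\<open>N\<close> periods of length \<open>d n\<close> cover the support, so
      \<open>N\<close> can serve as the number of summands for all three periods.\<close>
    then have "real d * real N \<le> real N * real (d * n)" by (simp add: mult_ac)
    then have out': "g t = 0" if "t \<notin> {0..<real N * real (d * n)}" for t
      using that by (intro out) (auto simp: T123_eq)
    define A where "A t \<longleftrightarrow> t \<in> {0..<real (d * n)} \<longrightarrow>
      (\<Sum>k<N. g (t + k * real (d * n))) = (LINT t|lborel. g t) / real (d * n)" for t
    have "AE t in lborel. A t"
      unfolding A_def
    proof (rule periodization_constant [OF g out'])
      show "real (d * n) > 0" using \<open>n > 0\<close> \<open>d > 0\<close> by simp
    next
      show "orth_periodic (real (d * n)) g" using n by (intro orth) auto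
    qed
    moreover have "Measurable.pred borel A"
      unfolding A_def by measurable
    ultimately have "AE s in lborel. A (real d * real j + 1 * s)" for j
      by (intro AE_borel_affine [where P = A]) simp_all
    \<comment> \<open>Countably many exceptional null sets are united, so that one \<open>s\<close>
      works for all residues \<open>j\<close>.\<close>
    then have "AE s in lborel. \<forall>j. A (real d * real j + 1 * s)"
      unfolding AE_all_countable by (rule allI)
    then show ?thesis
    proof eventually_elim
      case (elim s)
      show ?case
      proof (intro impI allI)
        fix j assume s: "s \<in> {0..<real d}" and "j < n"
        then have "real d + real d * real j \<le> real (d * n)" by (simp add: less_imp_mult_Suc_le)
        with s have "real d * real j + 1 * s \<in> {0..<real (d * n)}" by simp
        with elim have "(\<Sum>k<N. g (real d * real j + 1 * s + k * real (d * n))) = (LINT t|lborel. g t) / real (d * n)"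
          unfolding A_def by blast
        then show "(\<Sum>k<N. g (s + real d * real (j + n * k))) = I / n"
          by (simp add: I_def algebra_simps)
      qed
    qed
  qed
  define B where "B s \<longleftrightarrow> s \<in> {0..<real d} \<longrightarrow> (\<forall>k. g (s + real d * real k) = l * coeff (P * h2_poly) k)" for s
  have "AE s in lborel. \<forall>n\<in>{a, b, c}. s \<in> {0..<real d} \<longrightarrow>
      (\<forall>j<n. (\<Sum>k<N. g (s + real d * real (j + n * k))) = I / n)"
    using sums by (intro AE_finite_allI) simp_all
  then have "AE s in lborel. B s"
  proof eventually_elim
    case (elim s)
    show ?case
      unfolding B_def
    proof (intro impI allI)
      fix k assume s: "s \<in> {0..<real d}"
      show "g (s + real d * real k) = l * coeff (P * h2_poly) k"
        unfolding l_def
      proof (rule fiber_eq_multiple [OF P, of "\<lambda>k. g (s + real d * real k)"])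
        fix k assume "k \<ge> N"
        then have "real d * real N \<le> real d * real k" by (intro mult_left_mono) simp_all
        then have "real d * real N \<le> s + real d * real k"
          using s unfolding atLeastLessThan_iff by linarith
        then show "g (s + real d * real k) = 0" by (intro out) (simp add: T123_eq)
      next
        fix n j assume "n \<in> {a, b, c}" "j < n"
        then show "(\<Sum>k<N. g (s + real d * real (j + n * k))) = I / real n"
          using elim s by blast
      qed
    qed
  qed
  moreover have "Measurable.pred borel B"
    unfolding B_def by measurable
  \<comment> \<open>The base point of the fiber through \<open>t\<close> is \<open>t - d m\<close>
    with \<open>m\<close> depending on \<open>t\<close>; hence \<open>B\<close> is required at all
    these translates at once.\<close>
  ultimately have "AE t in lborel. B (- real d * real m + 1 * t)" for m
    by (intro AE_borel_affine [where P = B]) simp_all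
  then have "AE t in lborel. \<forall>m. B (- real d * real m + 1 * t)"
    unfolding AE_all_countable by (rule allI)
  then have main: "AE t in lborel. g t = l * \<phi> t"
  proof eventually_elim
    case (elim t)
    show ?case
    proof (cases "t < 0")
      case True
      then show ?thesis using out [of t] \<phi> by (simp add: step_poly_def)
    next
      case False
      define m where "m = nat \<lfloor>t / d\<rfloor>"
      define s where "s = t - real d * real m"
      have "real m \<le> t / d" "t / d < real m + 1"
        using False \<open>d > 0\<close> by (auto simp: m_def)
      then have s: "s \<in> {0..<real d}"
        using \<open>d > 0\<close> by (simp add: s_def field_simps)
      have t: "t = s + real d * real m" by (simp add: s_def)
      have "B s"
        using elim [rule_format, of m] by (simp add: s_def)
      with s have "g t = l * coeff (P * h2_poly) m"
        unfolding B_def t by blast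
      also have "\<dots> = l * \<phi> t"
        using \<phi> s unfolding step_poly_def t by simp
      finally show ?thesis .
    qed
  qed
  have hl: "AE t in lebesgue. h t = l * \<phi> t"
    using AE_completion [OF eq] AE_completion [OF main] by eventually_elim simp
  then have "l \<noteq> 0"
    using h unfolding is_h3_def by auto
  \<comment> \<open>Since \<open>h\<close> is \<open>l\<close> times the step function, the constant
    in front of \<open>h\<close> is \<open>1 / l\<close>.\<close>
  with hl show ?thesis
    by (intro exI [of _ "1 / l"]) (auto elim: eventually_mono)
qed

text \<open>The witness for the sequence is \<open>coeff P\<close>. In each case it is identified by
  a series that satisfies the equation of \<open>F\<close>.\<close>

lemma (in three_periods) h3_decomposition:
  assumes h: "is_h3 (d * a) (d * b) (d * c) h" and "d > 0"
  shows "\<exists>(p::nat) (q::nat) (r::nat) (a' :: nat \<Rightarrow> real).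
    p > 0 \<and> q > 0 \<and> r > 0 \<and>
    (\<exists>c'::real. c' \<noteq> 0 \<and>
       (AE t in lebesgue. c' * h t =
          (\<Sum>j\<le>last_index p q r. a' j * h2 (d * a) (d * b) (t - real j * real (gcd3 (d * a) (d * b) (d * c)))))) \<and>
    (q = 1 \<longrightarrow>
       last_index p q r = p * r - r \<and>
       (\<forall>j\<le>last_index p q r. a' j = rep (1 # replicate (r - 1) 0) j)) \<and>
    (r = 1 \<longrightarrow>
       last_index p q r = p * q - q \<and>
       (\<forall>j\<le>last_index p q r. a' j = rep (1 # replicate (q - 1) 0) j)) \<and>
    (q \<ge> 2 \<and> r \<ge> 2 \<longrightarrow>
       (\<exists>b :: nat \<Rightarrow> real. (\<forall>j. b (j + q * r) = b j) \<and> (\<forall>j\<le>last_index p q r. a' j = b j)) \<and>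
       (\<forall>j\<le>last_index p q r. a' j = shifted_sum q r j) \<and>
       shifted_sum q r = shifted_sum r q)"
proof -
  obtain P :: "real poly" where P: "geo_poly 1 (p * q * r) = P * geo_poly 1 q * geo_poly 1 r"
    by (rule geo_poly_quotient_exists [OF coprime_q_r q_pos r_pos])
  have "step_poly d (\<lambda>t. \<Sum>j\<le>last_index p q r. coeff P j * h2 (d * a) (d * b) (t - real j * real d)) (P * h2_poly)"
    using degree_geo_poly_quotient [OF P p_pos q_pos r_pos] step_poly_h2 [OF \<open>d > 0\<close>]
    by (intro step_poly_coeff_sum) auto
  from h3_multiple [OF h \<open>d > 0\<close> P this]
  have 1: "\<exists>c'. c' \<noteq> 0 \<and> (AE t in lebesgue. c' * h t =
      (\<Sum>j\<le>last_index p q r. coeff P j * h2 (d * a) (d * b) (t - real j * real (gcd3 (d * a) (d * b) (d * c)))))"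
    unfolding gcd3_eq .
  have coeff: "coeff P j = fps_nth F j"
    if "F * (1 - fps_X ^ q) * (1 - fps_X ^ r) = 1 - fps_X" "j \<le> last_index p q r" for F j
    using coeff_geo_poly_quotient [OF P that(1) p_pos q_pos r_pos that(2)] .
  \<comment> \<open>For \<open>q = 1\<close> the equation of \<open>F\<close> reduces to
    \<open>F (1 - x^r) = 1\<close>, solved by \<open>fps_rep_one\<close>; \<open>r = 1\<close> is
    symmetric.\<close>
  have 2: "last_index p q r = p * r - r \<and> (\<forall>j\<le>last_index p q r. coeff P j = rep (1 # replicate (r - 1) 0) j)"
    if "q = 1"
    using coeff [of "Abs_fps (rep (1 # replicate (r - 1) 0))"] fps_rep_one [OF r_pos] that
    by (simp add: last_index_def mult_ac)
  have 3: "last_index p q r = p * q - q \<and> (\<forall>j\<le>last_index p q r. coeff P j = rep (1 # replicate (q - 1) 0) j)"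
    if "r = 1"
    using coeff [of "Abs_fps (rep (1 # replicate (q - 1) 0))"] fps_rep_one [OF q_pos] that
    by (simp add: last_index_def)
  have 4: "(\<exists>b :: nat \<Rightarrow> real. (\<forall>j. b (j + q * r) = b j) \<and> (\<forall>j\<le>last_index p q r. coeff P j = b j)) \<and>
       (\<forall>j\<le>last_index p q r. coeff P j = shifted_sum q r j) \<and> shifted_sum q r = shifted_sum r q"
    if "q \<ge> 2" "r \<ge> 2"
  proof -
    let ?F = "Abs_fps (shifted_sum q r)" and ?G = "Abs_fps (shifted_sum r q)"
    have F: "?F * (1 - fps_X ^ q) * (1 - fps_X ^ r) = 1 - fps_X"
      using fps_shifted_sum [OF q_pos \<open>r \<ge> 2\<close>] .
    have "?G * (1 - fps_X ^ q) * (1 - fps_X ^ r) = 1 - fps_X"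
      using fps_shifted_sum [OF r_pos \<open>q \<ge> 2\<close>] by (simp only: ac_simps)
    \<comment> \<open>Both series solve the same equation, whose nonzero factors cancel.\<close>
    with F have "?F = ?G"
      by (metis mult_right_cancel one_minus_X_power_nonzero q_pos r_pos)
    then have "shifted_sum q r = shifted_sum r q"
      by (simp add: fps_eq_iff fun_eq_iff)
    moreover have "shifted_sum q r (j + q * r) = shifted_sum q r j" for j
      using fps_periodic [OF F coprime_q_r \<open>q \<ge> 2\<close> r_pos] by simp
    ultimately show ?thesis
      using coeff [OF F] by auto
  qed
  show ?thesis
    by (rule exI [of _ p], rule exI [of _ q], rule exI [of _ r], rule exI [of _ "coeff P"])
      (use 1 2 3 4 p_pos q_pos r_pos in blast)
qed

theorem theorem1p2:
  fixes T1 T2 T3 :: nat and h3 :: "real \<Rightarrow> real"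
  assumes "T1 > 0" and "T2 > 0" and "T3 > 0"
    and "is_h3 T1 T2 T3 h3"
  shows "\<exists>(p::nat) (q::nat) (r::nat) (a :: nat \<Rightarrow> real).
    p > 0 \<and> q > 0 \<and> r > 0 \<and>
    (\<exists>c::real. c \<noteq> 0 \<and>
       (AE t in lebesgue. c * h3 t =
          (\<Sum>j\<le>last_index p q r. a j * h2 T1 T2 (t - real j * real (gcd3 T1 T2 T3))))) \<and>
    (q = 1 \<longrightarrow>
       last_index p q r = p * r - r \<and>
       (\<forall>j\<le>last_index p q r. a j = rep (1 # replicate (r - 1) 0) j)) \<and>
    (r = 1 \<longrightarrow>
       last_index p q r = p * q - q \<and>
       (\<forall>j\<le>last_index p q r. a j = rep (1 # replicate (q - 1) 0) j)) \<and>
    (q \<ge> 2 \<and> r \<ge> 2 \<longrightarrow>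
       (\<exists>b :: nat \<Rightarrow> real. (\<forall>j. b (j + q * r) = b j) \<and> (\<forall>j\<le>last_index p q r. a j = b j)) \<and>
       (\<forall>j\<le>last_index p q r. a j = shifted_sum q r j) \<and>
       shifted_sum q r = shifted_sum r q)"
proof -
  define d where "d = gcd3 T1 T2 T3"
  have d: "d > 0" "d dvd T1" "d dvd T2" "d dvd T3"
    using assms by (auto simp: d_def gcd3_def intro: dvd_trans [OF gcd_dvd2])
  then obtain a b c where T: "T1 = d * a" "T2 = d * b" "T3 = d * c"
    by (auto elim!: dvdE)
  \<comment> \<open>Dividing out \<open>d\<close> leaves a jointly coprime triple, as the locale
    demands.\<close>
  have "d * gcd a (gcd b c) = d * 1"
    using d_def by (simp add: gcd3_def T gcd_mult_distrib_nat)
  then have "gcd a (gcd b c) = 1"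
    using \<open>d > 0\<close> by simp
  then interpret three_periods a b c
    using assms T by unfold_locales auto
  show ?thesis
    using h3_decomposition [OF _ \<open>d > 0\<close>, folded T] assms(4) by simp
qed

end
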